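(* For any integer $r \ge 2$ there is a constant $C = C(r)$ such that if $p > C\left(\frac{\log n}{n}\right)^{1/r}$, then w.h.p. $G \sim \mathcal{G}(n,p)$ satisfies $\mathrm{tc}_r(G) \le r^2$.
   Context: For a graph $G$ and a positive integer $r$, $\mathrm{tc}_r(G)$ is the minimum integer $m$ such that for every colouring of the edges of $G$ with $r$ colours, there exist $m$ monochromatic trees (equivalently, monochromatic connected components, where a single vertex counts as a component in each colour) whose vertex sets together cover $V(G)$. $\mathcal{G}(n,p)$ is the binomial random graph; "w.h.p." means with probability tending to $1$ as $n\to\infty$. *)

theory Defs
  imports "HOL-Probability.Probability" "HOL-Library.Ramsey"
begin

section \<open>Simple graphs and trees\<close>

text \<open>An edge is a two-element set of vertices; \<open>[A]\<^bsup>2\<^esup>\<close> from Ramsey theory denotes the set of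
  two-element subsets of \<open>A\<close>.\<close>

record 'a ugraph =
  verts :: "'a set"
  edges :: "'a set set"

definition simple_graph :: "'a ugraph \<Rightarrow> bool" where
  "simple_graph G \<longleftrightarrow> edges G \<subseteq> [verts G]\<^bsup>2\<^esup>"

definition subgraph :: "'a ugraph \<Rightarrow> 'a ugraph \<Rightarrow> bool" where
  "subgraph H G \<longleftrightarrow> simple_graph H \<and> verts H \<subseteq> verts G \<and> edges H \<subseteq> edges G"

definition connected_graph :: "'a ugraph \<Rightarrow> bool" where
  "connected_graph G \<longleftrightarrow>
     verts G \<noteq> {} \<and> (\<forall>u\<in>verts G. \<forall>v\<in>verts G. (u, v) \<in> {(x, y). {x, y} \<in> edges G}\<^sup>*)"

definition is_cycle :: "'a ugraph \<Rightarrow> 'a list \<Rightarrow> bool" where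
  "is_cycle G xs \<longleftrightarrow>
     3 \<le> length xs \<and> distinct xs \<and>
     (\<forall>i<length xs. {xs ! i, xs ! (Suc i mod length xs)} \<in> edges G)"

definition is_tree :: "'a ugraph \<Rightarrow> bool" where
  "is_tree T \<longleftrightarrow> simple_graph T \<and> connected_graph T \<and> (\<nexists>xs. is_cycle T xs)"


section \<open>Monochromatic tree covers\<close>

text \<open>The colours are \<open>0, \<dots>, r - 1\<close>. Values of a colouring outside \<open>edges G\<close> are irrelevant.\<close>

definition edge_colouring :: "nat \<Rightarrow> 'a ugraph \<Rightarrow> ('a set \<Rightarrow> nat) \<Rightarrow> bool" where
  "edge_colouring r G c \<longleftrightarrow> (\<forall>e\<in>edges G. c e < r)"

text \<open>A single vertex is a monochromatic tree, in every colour.\<close>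

definition mono_tree :: "nat \<Rightarrow> 'a ugraph \<Rightarrow> ('a set \<Rightarrow> nat) \<Rightarrow> 'a ugraph \<Rightarrow> bool" where
  "mono_tree r G c T \<longleftrightarrow> subgraph T G \<and> is_tree T \<and> (\<exists>i<r. \<forall>e\<in>edges T. c e = i)"

text \<open>The trees need not be disjoint. Bounding the cardinality by \<open>m\<close> amounts to allowing
  repetitions among \<open>m\<close> trees.\<close>

definition tree_coverable :: "nat \<Rightarrow> 'a ugraph \<Rightarrow> nat \<Rightarrow> bool" where
  "tree_coverable r G m \<longleftrightarrow>
     (\<forall>c. edge_colouring r G c \<longrightarrow>
        (\<exists>\<T>. finite \<T> \<and> card \<T> \<le> m \<and> (\<forall>T\<in>\<T>. mono_tree r G c T) \<and>
             (\<Union>T\<in>\<T>. verts T) = verts G))"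

definition tc :: "nat \<Rightarrow> 'a ugraph \<Rightarrow> nat" where
  "tc r G = (LEAST m. tree_coverable r G m)"

text \<open>For finite graphs the minimum is attained, as the single vertices form a cover.\<close>

lemma tree_coverable_card_verts:
  assumes "finite (verts G)" "0 < r"
  shows "tree_coverable r G (card (verts G))"
  unfolding tree_coverable_def
proof (intro allI impI)
  fix c
  let ?s = "\<lambda>v. \<lparr>verts = {v}, edges = {}\<rparr>"
  have "finite (?s ` verts G)" "card (?s ` verts G) \<le> card (verts G)"
    using assms(1) by (auto intro: card_image_le)
  moreover have "\<forall>T\<in>?s ` verts G. mono_tree r G c T"
    using assms(2)
    by (auto simp: mono_tree_def subgraph_def is_tree_def simple_graph_def connected_graph_def
        is_cycle_def intro!: exI[of _ 0])
  moreover have "(\<Union>T\<in>?s ` verts G. verts T) = verts G"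
    by auto
  ultimately show "\<exists>\<T>. finite \<T> \<and> card \<T> \<le> card (verts G) \<and> (\<forall>T\<in>\<T>. mono_tree r G c T) \<and>
      (\<Union>T\<in>\<T>. verts T) = verts G"
    by blast
qed

lemma tc_le_iff:
  assumes "finite (verts G)" "0 < r"
  shows "tc r G \<le> m \<longleftrightarrow> tree_coverable r G m"
proof
  assume "tc r G \<le> m"
  moreover have "tree_coverable r G (tc r G)"
    unfolding tc_def using tree_coverable_card_verts[OF assms] by (rule LeastI)
  ultimately show "tree_coverable r G m"
    unfolding tree_coverable_def by (meson le_trans)
next
  assume "tree_coverable r G m"
  then show "tc r G \<le> m"
    unfolding tc_def by (rule Least_le)
qed


section \<open>The binomial random graph\<close>

text \<open>\<^const>\<open>bernoulli_pmf\<close> truncates its parameter to the unit interval, so \<open>p\<close> is meant to lie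
  in it.\<close>

definition gnp :: "nat \<Rightarrow> real \<Rightarrow> nat ugraph pmf" where
  "gnp n p =
     map_pmf (\<lambda>f. \<lparr>verts = {..<n}, edges = {e \<in> [{..<n}]\<^bsup>2\<^esup>. f e}\<rparr>)
       (Pi_pmf ([{..<n}]\<^bsup>2\<^esup>) False (\<lambda>_. bernoulli_pmf p))"

end

theory Submission
  imports Defs
begin

text \<open>Fix a colouring. Say that two vertices meet if they share a monochromatic component, and call
  the set of all vertices lying in the same component as \<open>x\<close> in every colour the class of \<open>x\<close>.
  If no \<open>r\<^sup>2\<close> components cover the graph, then for any \<open>r\<close> vertices some further vertex meets none
  of them, since \<open>r\<close> vertices lie in at most \<open>r\<^sup>2\<close> components altogether.

  With high probability, any \<open>r - 1\<close> vertices and any set of \<open>m < 1/p\<close> vertices have more than \<open>r\<^sup>r m\<close>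
  joint neighbours, that is, vertices adjacent to all of the former and to some of the latter. If the
  \<open>r - 1\<close> vertices and the set, taken inside one class, pairwise do not meet, then a joint neighbour
  is attached to them in \<open>r\<close> distinct colours, and the assignment of the colours determines its class.
  Hence some class has more than \<open>m\<close> elements, and so there are classes of size at least \<open>1/p\<close>, even
  among the vertices not meeting a given one.

  Take two such classes that do not meet and \<open>r - 1\<close> further vertices meeting neither them nor each
  other. With high probability there is a joint neighbour of these \<open>r + 1\<close> objects. It is attached to
  two of them in the same colour, so these two meet, a contradiction.\<close>

section \<open>Spanning trees\<close>

abbreviation adj_rel :: "'a set set \<Rightarrow> ('a \<times> 'a) set" where
  "adj_rel E \<equiv> {(x, y). {x, y} \<in> E}"

lemma sym_rtrancl_adj_rel: "(x, y) \<in> (adj_rel E)\<^sup>* \<Longrightarrow> (y, x) \<in> (adj_rel E)\<^sup>*"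
proof -
  have "sym ((adj_rel E)\<^sup>*)"
    by (rule sym_rtrancl) (auto simp: sym_def insert_commute)
  then show "(x, y) \<in> (adj_rel E)\<^sup>* \<Longrightarrow> (y, x) \<in> (adj_rel E)\<^sup>*"
    by (rule symD)
qed

text \<open>The removed edge is the one closing the cycle. Its ends remain joined by the path along
  the rest of the cycle, so every use of the edge can be replaced by this detour.\<close>

lemma rtrancl_subset_if_cycle_edge_removed:
  assumes cyc: "is_cycle \<lparr>verts = V, edges = F\<rparr> xs"
  shows "\<exists>e\<in>F. (adj_rel F)\<^sup>* \<subseteq> (adj_rel (F - {e}))\<^sup>*"
proof -
  define k where "k = length xs"
  have k: "3 \<le> k" and d: "distinct xs"
    and ed: "\<And>i. i < k \<Longrightarrow> {xs ! i, xs ! (Suc i mod k)} \<in> F"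
    using cyc by (auto simp: is_cycle_def k_def)
  define e where "e = {xs ! (k - 1), xs ! 0}"
  have eF: "e \<in> F"
    using ed[of "k - 1"] k by (simp add: e_def)
  have step: "{xs ! i, xs ! Suc i} \<in> F - {e}" if "Suc i < k" for i
  proof -
    have "{xs ! i, xs ! Suc i} \<noteq> e"
    proof
      assume "{xs ! i, xs ! Suc i} = e"
      \<comment> \<open>By distinctness the first case gives \<open>Suc i = 0\<close>, the second
        \<open>i = 0\<close> and \<open>k = 2\<close>; the latter is excluded by
        \<open>3 \<le> k\<close>.\<close>
      then have "xs ! Suc i = xs ! 0 \<or> xs ! i = xs ! 0 \<and> xs ! Suc i = xs ! (k - 1)"
        by (auto simp: e_def doubleton_eq_iff)
      moreover have "xs ! a = xs ! b \<longleftrightarrow> a = b" if "a < k" "b < k" for a b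
        using d that nth_eq_iff_index_eq by (metis k_def)
      ultimately show False
        using that k by auto
    qed
    then show ?thesis
      using ed[of i] that by simp
  qed
  have path: "(xs ! 0, xs ! i) \<in> (adj_rel (F - {e}))\<^sup>*" if "i < k" for i
    using that
  proof (induction i)
    case (Suc i)
    then show ?case
      using step[of i] by (auto intro: rtrancl_into_rtrancl)
  qed simp
  have last: "(xs ! 0, xs ! (k - 1)) \<in> (adj_rel (F - {e}))\<^sup>*"
    using path[of "k - 1"] k by simp
  have "adj_rel F \<subseteq> (adj_rel (F - {e}))\<^sup>*"
  proof (clarify)
    fix x y assume xy: "{x, y} \<in> F"
    show "(x, y) \<in> (adj_rel (F - {e}))\<^sup>*"
    proof (cases "{x, y} = e")
      case True
      then show ?thesis
        using last sym_rtrancl_adj_rel[OF last] by (auto simp: e_def doubleton_eq_iff)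
    qed (use xy in auto)
  qed
  then have "(adj_rel F)\<^sup>* \<subseteq> (adj_rel (F - {e}))\<^sup>*"
    by (rule rtrancl_subset_rtrancl)
  with eF show ?thesis by blast
qed

text \<open>As long as there is a cycle, one of its edges can be deleted without disconnecting the
  graph; induction on the number of edges.\<close>

lemma connected_graph_has_spanning_tree:
  assumes "finite F" "simple_graph \<lparr>verts = V, edges = F\<rparr>" "connected_graph \<lparr>verts = V, edges = F\<rparr>"
  shows "\<exists>F'\<subseteq>F. is_tree \<lparr>verts = V, edges = F'\<rparr>"
  using assms
proof (induction "card F" arbitrary: F rule: less_induct)
  case less
  show ?case
  proof (cases "\<exists>xs. is_cycle \<lparr>verts = V, edges = F\<rparr> xs")
    case False
    then show ?thesis
      using less.prems by (auto simp: is_tree_def)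
  next
    case True
    then obtain e where e: "e \<in> F" "(adj_rel F)\<^sup>* \<subseteq> (adj_rel (F - {e}))\<^sup>*"
      using rtrancl_subset_if_cycle_edge_removed by blast
    have "\<exists>F'\<subseteq>F - {e}. is_tree \<lparr>verts = V, edges = F'\<rparr>"
    proof (rule less.hyps)
      show "card (F - {e}) < card F"
        using e less.prems by (meson card_Diff1_less)
      show "simple_graph \<lparr>verts = V, edges = F - {e}\<rparr>"
        using less.prems by (auto simp: simple_graph_def)
      show "connected_graph \<lparr>verts = V, edges = F - {e}\<rparr>"
        using less.prems e(2) by (auto simp: connected_graph_def)
    qed (use less.prems in auto)
    then show ?thesis by blast
  qed
qed

section \<open>Monochromatic components\<close>

definition mono_connected :: "'a ugraph \<Rightarrow> ('a set \<Rightarrow> nat) \<Rightarrow> nat \<Rightarrow> 'a \<Rightarrow> 'a \<Rightarrow> bool" where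
  "mono_connected G c i x y \<longleftrightarrow> (x, y) \<in> (adj_rel {e \<in> edges G. c e = i})\<^sup>*"

lemma mono_connected_refl [simp]: "mono_connected G c i x x"
  by (simp add: mono_connected_def)

lemma mono_connected_sym: "mono_connected G c i x y \<Longrightarrow> mono_connected G c i y x"
  unfolding mono_connected_def by (rule sym_rtrancl_adj_rel)

lemma mono_connected_trans:
  "mono_connected G c i x y \<Longrightarrow> mono_connected G c i y z \<Longrightarrow> mono_connected G c i x z"
  unfolding mono_connected_def by (rule rtrancl_trans)

lemma mono_connected_edge: "{x, y} \<in> edges G \<Longrightarrow> mono_connected G c (c {x, y}) x y"
  unfolding mono_connected_def by auto

lemma mono_component_has_spanning_tree:
  assumes "finite (verts G)" "simple_graph G" "i < r" "x \<in> verts G"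
  shows "\<exists>T. mono_tree r G c T \<and> verts T = {y. mono_connected G c i x y}"
proof -
  define V where "V = {y. mono_connected G c i x y}"
  define F where "F = {e \<in> edges G. c e = i \<and> e \<subseteq> V}"
  have E: "\<And>e. e \<in> edges G \<Longrightarrow> e \<in> [verts G]\<^bsup>2\<^esup>"
    using assms(2) by (auto simp: simple_graph_def)
  have Vsub: "V \<subseteq> verts G"
  proof
    fix y assume "y \<in> V"
    then have "(x, y) \<in> (adj_rel {e \<in> edges G. c e = i})\<^sup>*"
      by (simp add: V_def mono_connected_def)
    then show "y \<in> verts G"
    proof (induction rule: rtrancl_induct)
      case (step y z)
      then show ?case using E[of "{y, z}"] by auto
    qed (rule assms(4))
  qed
  \<comment> \<open>A path of colour \<open>i\<close> starting at \<open>x\<close> never leaves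
    \<open>V\<close>, since each of its initial segments ends in the component. Hence all its edges
    belong to \<open>F\<close>.\<close>
  have from_x: "(x, y) \<in> (adj_rel F)\<^sup>*" if "y \<in> V" for y
  proof -
    from that have "(x, y) \<in> (adj_rel {e \<in> edges G. c e = i})\<^sup>*"
      by (simp add: V_def mono_connected_def)
    then show ?thesis
    proof (induction rule: rtrancl_induct)
      case (step y z)
      have "y \<in> V" "z \<in> V"
        using step(1,2) by (auto simp: V_def mono_connected_def intro: rtrancl_into_rtrancl)
      with step show ?case
        by (auto simp: F_def intro: rtrancl_into_rtrancl)
    qed simp
  qed
  have "F \<subseteq> [V]\<^bsup>2\<^esup>"
    using E by (auto simp: F_def nsets_def)
  moreover have "finite F"
    by (rule finite_subset[OF \<open>F \<subseteq> [V]\<^bsup>2\<^esup>\<close>]) (use Vsub assms(1) finite_imp_finite_nsets finite_subset in blast)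
  moreover have "connected_graph \<lparr>verts = V, edges = F\<rparr>"
    unfolding connected_graph_def
  proof (intro conjI ballI)
    show "verts \<lparr>verts = V, edges = F\<rparr> \<noteq> {}"
      using mono_connected_refl[of G c i x] by (auto simp: V_def simp del: mono_connected_refl)
    fix u v assume "u \<in> verts \<lparr>verts = V, edges = F\<rparr>" "v \<in> verts \<lparr>verts = V, edges = F\<rparr>"
    then show "(u, v) \<in> (adj_rel (edges \<lparr>verts = V, edges = F\<rparr>))\<^sup>*"
      using rtrancl_trans[OF sym_rtrancl_adj_rel[OF from_x] from_x] by simp
  qed
  ultimately obtain F' where F': "F' \<subseteq> F" "is_tree \<lparr>verts = V, edges = F'\<rparr>"
    using connected_graph_has_spanning_tree[of F V] by (auto simp: simple_graph_def)
  have "mono_tree r G c \<lparr>verts = V, edges = F'\<rparr>"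
    unfolding mono_tree_def subgraph_def
    using F' Vsub assms(3) by (auto simp: is_tree_def F_def)
  then show ?thesis
    by (intro exI[of _ "\<lparr>verts = V, edges = F'\<rparr>"]) (simp add: V_def)
qed

text \<open>Not transitive in general, because the two colours involved may differ.\<close>

definition mono_meet :: "nat \<Rightarrow> 'a ugraph \<Rightarrow> ('a set \<Rightarrow> nat) \<Rightarrow> 'a \<Rightarrow> 'a \<Rightarrow> bool" where
  "mono_meet r G c x y \<longleftrightarrow> (\<exists>i<r. mono_connected G c i x y)"

lemma mono_meet_sym: "mono_meet r G c x y \<Longrightarrow> mono_meet r G c y x"
  unfolding mono_meet_def using mono_connected_sym by metis

text \<open>At most \<open>r\<close> vertices, each in one component per colour, give at most
  \<open>r ^ 2\<close> components; a spanning tree of each is taken. Contraposed, a graph without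
  such a cover has, for any \<open>r\<close> vertices, a vertex that meets none of them.\<close>

lemma mono_cover_by_components:
  assumes "finite (verts G)" "simple_graph G" "K \<subseteq> verts G" "card K \<le> r"
    and cover: "\<And>x. x \<in> verts G \<Longrightarrow> \<exists>v\<in>K. mono_meet r G c v x"
  shows "\<exists>\<T>. finite \<T> \<and> card \<T> \<le> r ^ 2 \<and> (\<forall>T\<in>\<T>. mono_tree r G c T) \<and> (\<Union>T\<in>\<T>. verts T) = verts G"
proof -
  have "\<forall>z\<in>K \<times> {..<r}. \<exists>T. mono_tree r G c T \<and> verts T = {y. mono_connected G c (snd z) (fst z) y}"
    using mono_component_has_spanning_tree assms(1-3) by fastforce
  then obtain T where T: "\<And>v i. v \<in> K \<Longrightarrow> i < r \<Longrightarrow>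
      mono_tree r G c (T (v, i)) \<and> verts (T (v, i)) = {y. mono_connected G c i v y}"
    by (metis SigmaI fst_conv lessThan_iff snd_conv bchoice)
  have fin: "finite K"
    using assms(1,3) finite_subset by blast
  show ?thesis
  proof (intro exI[of _ "T ` (K \<times> {..<r})"] conjI)
    have "card (T ` (K \<times> {..<r})) \<le> card (K \<times> {..<r})"
      using fin by (intro card_image_le) auto
    also have "\<dots> \<le> r ^ 2"
      using assms(4) by (simp add: card_cartesian_product power2_eq_square)
    finally show "card (T ` (K \<times> {..<r})) \<le> r ^ 2" .
    show "(\<Union>T\<in>T ` (K \<times> {..<r}). verts T) = verts G"
    proof
      show "(\<Union>T\<in>T ` (K \<times> {..<r}). verts T) \<subseteq> verts G"
        using T by (fastforce simp: mono_tree_def subgraph_def)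
      show "verts G \<subseteq> (\<Union>T\<in>T ` (K \<times> {..<r}). verts T)"
      proof
        fix x assume "x \<in> verts G"
        then obtain v i where "v \<in> K" "i < r" "mono_connected G c i v x"
          using cover unfolding mono_meet_def by blast
        then show "x \<in> (\<Union>T\<in>T ` (K \<times> {..<r}). verts T)"
          using T[of v i] by auto
      qed
    qed
  qed (use fin T in auto)
qed

section \<open>Joint neighbours and classes\<close>

text \<open>Single vertices enter the family as singletons, so that vertices and larger sets are
  treated alike.\<close>

definition joint_neighbour :: "'a ugraph \<Rightarrow> 'a set set \<Rightarrow> 'a \<Rightarrow> bool" where
  "joint_neighbour G \<A> z \<longleftrightarrow> (\<forall>A\<in>\<A>. \<exists>w\<in>A. {z, w} \<in> edges G)"

section \<open>Colours in which a joint neighbour is attached\<close>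

locale coloured_graph =
  fixes r :: nat and G :: "'a ugraph" and c :: "'a set \<Rightarrow> nat"
  assumes fin: "finite (verts G)" and simple: "simple_graph G" and col: "edge_colouring r G c"
    and rpos: "0 < r"
begin

abbreviation conn :: "nat \<Rightarrow> 'a \<Rightarrow> 'a \<Rightarrow> bool" where "conn \<equiv> mono_connected G c"
abbreviation meet :: "'a \<Rightarrow> 'a \<Rightarrow> bool" where "meet \<equiv> mono_meet r G c"

definition cls :: "'a \<Rightarrow> 'a set" where
  "cls x = {y \<in> verts G. \<forall>i<r. conn i x y}"

definition scattered :: "'a set \<Rightarrow> bool" where
  "scattered U \<longleftrightarrow> pairwise (\<lambda>x y. \<not> meet x y) U"

lemma scattered_insert:
  "scattered U \<Longrightarrow> (\<And>u. u \<in> U \<Longrightarrow> \<not> meet x u) \<Longrightarrow> scattered (insert x U)"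
  by (auto simp: scattered_def pairwise_insert dest: mono_meet_sym)

lemma self_in_cls: "x \<in> verts G \<Longrightarrow> x \<in> cls x"
  by (simp add: cls_def)

lemma finite_cls: "finite (cls x)"
  using fin by (simp add: cls_def)

lemma meet_refl: "meet x x"
  using rpos by (auto simp: mono_meet_def)

lemma meet_cls: "y \<in> cls x \<Longrightarrow> meet x y"
  using rpos by (auto simp: cls_def mono_meet_def)

text \<open>A substitute for transitivity: whatever the colour in which \<open>z\<close> and
  \<open>y\<close> meet, \<open>y\<close> is connected to \<open>x\<close> in that colour
  too.\<close>

lemma cls_meet_trans:
  assumes "y \<in> cls x" "meet z y"
  shows "meet z x"
proof -
  obtain i where "i < r" "conn i z y"
    using assms(2) by (auto simp: mono_meet_def)
  moreover from this have "conn i y x"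
    using assms(1) by (auto simp: cls_def intro: mono_connected_sym)
  ultimately show ?thesis
    by (auto simp: mono_meet_def intro: mono_connected_trans)
qed

text \<open>The edge from \<open>z\<close> to some \<open>w\<close> in \<open>f t\<close> has one
  colour, and \<open>w\<close> is connected to \<open>t\<close> in every colour, in particular in
  this one.\<close>

lemma joint_neighbour_colours:
  assumes "joint_neighbour G (f ` T) z" "\<And>t. t \<in> T \<Longrightarrow> f t \<subseteq> cls t"
  shows "\<exists>\<pi>\<in>T \<rightarrow>\<^sub>E {..<r}. \<forall>t\<in>T. conn (\<pi> t) t z"
proof -
  have "\<exists>i<r. conn i t z" if t: "t \<in> T" for t
  proof -
    obtain w where w: "w \<in> f t" "{z, w} \<in> edges G"
      using assms(1) t by (auto simp: joint_neighbour_def)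
    have "c {z, w} < r"
      using w col by (auto simp: edge_colouring_def)
    moreover have "conn (c {z, w}) t w"
      using w assms(2)[OF t] \<open>c {z, w} < r\<close> by (auto simp: cls_def)
    ultimately show ?thesis
      using mono_connected_trans mono_connected_sym[OF mono_connected_edge[OF w(2)]] by metis
  qed
  then obtain \<pi> where "\<And>t. t \<in> T \<Longrightarrow> \<pi> t < r \<and> conn (\<pi> t) t z"
    by metis
  then show ?thesis
    \<comment> \<open>Restricting to \<open>T\<close> makes the assignment extensional, so that only
      finitely many assignments exist and they can be counted.\<close>
    by (intro bexI[of _ "restrict \<pi> T"]) auto
qed

text \<open>Two vertices with the same colour would be connected in it through \<open>z\<close>,
  hence would meet.\<close>

lemma scattered_colours_inj:
  assumes "scattered T" "\<pi> \<in> T \<rightarrow>\<^sub>E {..<r}" "\<forall>t\<in>T. conn (\<pi> t) t z"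
  shows "inj_on \<pi> T"
proof (rule inj_onI, rule ccontr)
  fix s t assume st: "s \<in> T" "t \<in> T" "\<pi> s = \<pi> t" "s \<noteq> t"
  then have "conn (\<pi> s) s t"
    using assms(3) mono_connected_trans mono_connected_sym by metis
  moreover have "\<pi> s < r"
    using assms(2) st by auto
  ultimately have "meet s t"
    by (auto simp: mono_meet_def)
  then show False
    using st assms(1) by (auto simp: scattered_def pairwise_def)
qed

end

section \<open>Large classes in a graph that cannot be covered\<close>

locale uncovered_graph = coloured_graph +
  assumes avoid: "\<And>K. K \<subseteq> verts G \<Longrightarrow> card K \<le> r \<Longrightarrow> \<exists>x\<in>verts G. \<forall>v\<in>K. \<not> meet v x"
begin

text \<open>Greedy choice. Before the last vertex is added, \<open>K\<close> and the vertices chosen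
  so far number at most \<open>r\<close>, so \<open>avoid\<close> still applies; this is why the
  bound is \<open>Suc r\<close>.\<close>

lemma scattered_extend:
  assumes "K \<subseteq> verts G" "card K + m \<le> Suc r"
  shows "\<exists>U\<subseteq>verts G. card U = m \<and> scattered U \<and> (\<forall>u\<in>U. \<forall>v\<in>K. \<not> meet v u)"
  using assms(2)
proof (induction m)
  case 0
  show ?case by (intro exI[of _ "{}"]) (auto simp: scattered_def)
next
  case (Suc m)
  then obtain U where U: "U \<subseteq> verts G" "card U = m" "scattered U" "\<forall>u\<in>U. \<forall>v\<in>K. \<not> meet v u"
    by auto
  have "card (K \<union> U) \<le> r"
    using card_Un_le[of K U] U(2) Suc.prems by linarith
  then obtain x where x: "x \<in> verts G" "\<forall>v\<in>K \<union> U. \<not> meet v x"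
    using avoid[of "K \<union> U"] assms(1) U(1) by blast
  have "x \<notin> U"
    using x meet_refl by blast
  moreover have "finite U"
    using U(1) fin finite_subset by blast
  moreover have "scattered (insert x U)"
    using U(3) x by (intro scattered_insert) (auto dest: mono_meet_sym)
  ultimately show ?case
    using U x by (intro exI[of _ "insert x U"]) auto
qed

text \<open>A class of maximal size among those avoiding \<open>K\<close> must be large: together with \<open>r - 1\<close> scattered
  vertices it has many joint neighbours, and each of these is determined up to its class by a
  bijection onto the colours, so some class is larger.\<close>

lemma large_class:
  assumes many: "\<And>U W. U \<subseteq> verts G \<Longrightarrow> W \<subseteq> verts G \<Longrightarrow> U \<inter> W = {} \<Longrightarrow> card U = r - 1 \<Longrightarrow>
      0 < card W \<Longrightarrow> card W < M \<Longrightarrow>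
      r ^ r * card W < card {z \<in> verts G - (U \<union> W). joint_neighbour G (insert W ((\<lambda>u. {u}) ` U)) z}"
    and K: "K \<subseteq> verts G" "card K \<le> 1"
  shows "\<exists>x\<in>verts G. (\<forall>v\<in>K. \<not> meet v x) \<and> M \<le> card (cls x)"
proof -
  define X where "X = {x \<in> verts G. \<forall>v\<in>K. \<not> meet v x}"
  have "X \<noteq> {}" "finite X"
    using avoid[OF K(1)] K(2) rpos fin by (auto simp: X_def)
  then obtain x where x: "x \<in> X" and "card (cls x) = (MAX y\<in>X. card (cls y))"
    by (metis obtains_MAX)
  then have max: "card (cls y) \<le> card (cls x)" if "y \<in> X" for y
    using that \<open>finite X\<close> by simp
  have "M \<le> card (cls x)"
  proof (rule ccontr)
    assume "\<not> M \<le> card (cls x)"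
    then have small: "card (cls x) < M" by simp
    have xV: "x \<in> verts G" and xK: "\<forall>v\<in>K. \<not> meet v x"
      using x by (auto simp: X_def)
    \<comment> \<open>As \<open>K\<close> has at most one element, exactly enough room is left for
      \<open>r - 1\<close> more vertices, which makes \<open>r\<close> together with
      \<open>x\<close>.\<close>
    have "card (insert x K) + (r - 1) \<le> Suc r"
      using K(2) card_insert_le_m1[of 2 K x] rpos by simp
    then obtain U where U: "U \<subseteq> verts G" "card U = r - 1" "scattered U"
      "\<forall>u\<in>U. \<forall>v\<in>insert x K. \<not> meet v u"
      using scattered_extend[of "insert x K" "r - 1"] xV K(1) by auto
    define T where "T = insert x U"
    have "x \<notin> U"
      using U(4) meet_refl by blast
    have finU: "finite U"
      using U(1) fin finite_subset by blast
    have cardT: "card T = r"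
      using \<open>x \<notin> U\<close> finU U(2) rpos by (simp add: T_def)
    have scT: "scattered T"
      unfolding T_def using U(3,4) by (intro scattered_insert) auto
    have TK: "\<forall>t\<in>T. \<forall>v\<in>K. \<not> meet v t"
      using U(4) xK by (auto simp: T_def)
    \<comment> \<open>The vertex \<open>x\<close> is represented by its whole class, the other
      vertices by themselves.\<close>
    define f where "f t = (if t = x then cls x else {t})" for t
    have fT: "f ` T = insert (cls x) ((\<lambda>u. {u}) ` U)"
      using \<open>x \<notin> U\<close> by (auto simp: f_def T_def)
    have fcls: "f t \<subseteq> cls t" if "t \<in> T" for t
      using that U(1) by (auto simp: f_def T_def self_in_cls)
    define Z where "Z = {z \<in> verts G - (U \<union> cls x). joint_neighbour G (f ` T) z}"
    have "U \<inter> cls x = {}"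
      using U(4) meet_cls by blast
    moreover have "0 < card (cls x)"
      using self_in_cls[OF xV] finite_cls card_gt_0_iff by blast
    ultimately have Z: "r ^ r * card (cls x) < card Z"
      using many[of U "cls x"] U(1,2) small unfolding Z_def fT by (auto simp: cls_def)
    have "\<forall>z\<in>Z. \<exists>\<pi>\<in>T \<rightarrow>\<^sub>E {..<r}. \<forall>t\<in>T. conn (\<pi> t) t z"
      using joint_neighbour_colours[of f T] fcls by (auto simp: Z_def)
    then obtain \<pi> where \<pi>: "\<And>z. z \<in> Z \<Longrightarrow> \<pi> z \<in> T \<rightarrow>\<^sub>E {..<r} \<and> (\<forall>t\<in>T. conn (\<pi> z t) t z)"
      by metis
    have finT: "finite T" using finU by (simp add: T_def)
    \<comment> \<open>There are \<open>r ^ r\<close> assignments of colours to \<open>T\<close>; the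
      factor \<open>r ^ r\<close> in \<open>many\<close> pays for this pigeonhole step.\<close>
    have "\<exists>\<rho>\<in>T \<rightarrow>\<^sub>E {..<r}. card Z \<le> card (\<pi> -` {\<rho>} \<inter> Z) * card (T \<rightarrow>\<^sub>E {..<r})"
    proof (rule pigeonhole_card)
      show "T \<rightarrow>\<^sub>E {..<r} \<noteq> {}"
        using rpos by (auto simp: PiE_eq_empty_iff)
    qed (use \<pi> fin finT in \<open>auto simp: Z_def intro!: finite_PiE\<close>)
    then obtain \<rho> where \<rho>: "\<rho> \<in> T \<rightarrow>\<^sub>E {..<r}" "card Z \<le> card (\<pi> -` {\<rho>} \<inter> Z) * r ^ r"
      using cardT finT by (auto simp: card_PiE)
    have "r ^ r * card (cls x) < r ^ r * card (\<pi> -` {\<rho>} \<inter> Z)"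
      using less_le_trans[OF Z \<rho>(2)] by (simp only: mult.commute)
    then have big: "card (cls x) < card (\<pi> -` {\<rho>} \<inter> Z)"
      using mult_less_cancel1 by blast
    then obtain z where z: "z \<in> Z" "\<pi> z = \<rho>"
      by (metis (no_types, lifting) Int_iff card.empty equals0I not_less_zero singletonD vimageE)
    have "inj_on \<rho> T"
      using scattered_colours_inj[OF scT] \<pi>[OF z(1)] z(2) by blast
    then have surj: "\<rho> ` T = {..<r}"
      using \<rho>(1) cardT finT by (intro card_subset_eq) (auto simp: card_image)
    \<comment> \<open>As \<open>\<rho>\<close> uses every colour, for each colour some element of
      \<open>T\<close> is connected in it to both \<open>z\<close> and \<open>y\<close>.\<close>
    have "\<pi> -` {\<rho>} \<inter> Z \<subseteq> cls z"
    proof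
      fix y assume y: "y \<in> \<pi> -` {\<rho>} \<inter> Z"
      have "conn i z y" if i: "i < r" for i
      proof -
        obtain t where t: "t \<in> T" "\<rho> t = i"
          using i surj by (metis imageE lessThan_iff)
        then have "conn i t z" "conn i t y"
          using \<pi>[of z] \<pi>[of y] y z by auto
        then show ?thesis
          using mono_connected_trans mono_connected_sym by metis
      qed
      then show "y \<in> cls z"
        using y by (auto simp: cls_def Z_def)
    qed
    then have "card (cls x) < card (cls z)"
      using big card_mono[OF finite_cls] by (meson less_le_trans)
    \<comment> \<open>If \<open>v\<close> met \<open>z\<close> in colour \<open>i\<close>, it would
      also meet the element of \<open>T\<close> that has colour \<open>i\<close>. So
      \<open>z\<close> competes in the maximum, and its larger class is a contradiction.\<close>
    moreover have "z \<in> X"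
    proof -
      have "\<not> meet v z" if v: "v \<in> K" for v
      proof
        assume "meet v z"
        then obtain i where i: "i < r" "conn i v z"
          by (auto simp: mono_meet_def)
        then obtain t where t: "t \<in> T" "\<rho> t = i"
          using surj by (metis imageE lessThan_iff)
        then have "conn i t z"
          using \<pi>[of z] z by auto
        then have "meet v t"
          using i mono_connected_trans mono_connected_sym unfolding mono_meet_def by metis
        then show False
          using TK t(1) v by blast
      qed
      then show ?thesis
        using z by (auto simp: X_def Z_def)
    qed
    ultimately show False
      using max[of z] by simp
  qed
  then show ?thesis
    using x by (auto simp: X_def)
qed

text \<open>With \<open>x\<close> and \<open>y\<close> there are \<open>r + 1\<close> pairwise
  non-meeting vertices, but the colours of a joint neighbour would map them injectively into
  \<open>r\<close> colours.\<close>

lemma two_large_classes_contradiction: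
  assumes joint: "\<And>U W W'. U \<subseteq> verts G \<Longrightarrow> W \<subseteq> verts G \<Longrightarrow> W' \<subseteq> verts G \<Longrightarrow>
      U \<inter> W = {} \<Longrightarrow> U \<inter> W' = {} \<Longrightarrow> W \<inter> W' = {} \<Longrightarrow> card U = r - 1 \<Longrightarrow> card W = M \<Longrightarrow> card W' = M \<Longrightarrow>
      \<exists>z. joint_neighbour G (insert W (insert W' ((\<lambda>u. {u}) ` U))) z"
    and x: "x \<in> verts G" "M \<le> card (cls x)"
    and y: "y \<in> verts G" "M \<le> card (cls y)"
    and xy: "\<not> meet x y"
  shows False
proof -
  have "card {x, y} + (r - 1) \<le> Suc r"
    using card_insert_le_m1[of 2 "{y}" x] rpos by simp
  then obtain U where U: "U \<subseteq> verts G" "card U = r - 1" "scattered U"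
    "\<forall>u\<in>U. \<forall>v\<in>{x, y}. \<not> meet v u"
    using scattered_extend[of "{x, y}" "r - 1"] x(1) y(1) by auto
  \<comment> \<open>The classes are cut down to size exactly \<open>M\<close>, since
    \<open>joint\<close> speaks about this one size only.\<close>
  obtain W W' where W: "W \<subseteq> cls x" "card W = M" "W' \<subseteq> cls y" "card W' = M"
    using x(2) y(2) by (meson obtain_subset_with_card_n)
  have disj: "cls x \<inter> cls y = {}"
    using xy cls_meet_trans meet_cls by blast
  have disjU: "U \<inter> cls x = {}" "U \<inter> cls y = {}"
    using U(4) meet_cls by blast+
  have ne: "x \<notin> U" "y \<notin> U" "x \<noteq> y"
    using U(4) xy meet_refl by blast+
  have finU: "finite U"
    using U(1) fin finite_subset by blast
  define T where "T = insert x (insert y U)"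
  define f where "f t = (if t = x then W else if t = y then W' else {t})" for t
  have fT: "f ` T = insert W (insert W' ((\<lambda>u. {u}) ` U))"
    using ne by (auto simp: f_def T_def)
  have fcls: "f t \<subseteq> cls t" if "t \<in> T" for t
    using that U(1) W by (auto simp: f_def T_def self_in_cls)
  obtain z where z: "joint_neighbour G (f ` T) z"
    unfolding fT
  proof (rule exE)
    show "\<exists>z. joint_neighbour G (insert W (insert W' ((\<lambda>u. {u}) ` U))) z"
    proof (rule joint)
      show "W \<subseteq> verts G" "W' \<subseteq> verts G"
        using W(1,3) by (auto simp: cls_def)
      show "U \<inter> W = {}" "U \<inter> W' = {}" "W \<inter> W' = {}"
        using W(1,3) disj disjU by blast+
    qed (fact U(1,2) W(2,4))+
  qed
  obtain \<pi> where \<pi>: "\<pi> \<in> T \<rightarrow>\<^sub>E {..<r}" "\<forall>t\<in>T. conn (\<pi> t) t z"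
    using joint_neighbour_colours[OF z fcls] by blast
  have "scattered T"
    unfolding T_def using U(3,4) xy by (intro scattered_insert) auto
  then have "inj_on \<pi> T"
    using scattered_colours_inj \<pi> by blast
  then have "card T \<le> card {..<r}"
    using \<pi>(1) by (intro card_inj_on_le) auto
  then show False
    using ne finU U(2) rpos by (simp add: T_def)
qed

end

lemma tree_coverable_if_joint_neighbours:
  assumes "finite (verts G)" "simple_graph G" "0 < r"
    and many: "\<And>U W. U \<subseteq> verts G \<Longrightarrow> W \<subseteq> verts G \<Longrightarrow> U \<inter> W = {} \<Longrightarrow> card U = r - 1 \<Longrightarrow>
      0 < card W \<Longrightarrow> card W < M \<Longrightarrow>
      r ^ r * card W < card {z \<in> verts G - (U \<union> W). joint_neighbour G (insert W ((\<lambda>u. {u}) ` U)) z}"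
    and joint: "\<And>U W W'. U \<subseteq> verts G \<Longrightarrow> W \<subseteq> verts G \<Longrightarrow> W' \<subseteq> verts G \<Longrightarrow>
      U \<inter> W = {} \<Longrightarrow> U \<inter> W' = {} \<Longrightarrow> W \<inter> W' = {} \<Longrightarrow> card U = r - 1 \<Longrightarrow> card W = M \<Longrightarrow> card W' = M \<Longrightarrow>
      \<exists>z. joint_neighbour G (insert W (insert W' ((\<lambda>u. {u}) ` U))) z"
  shows "tree_coverable r G (r ^ 2)"
  unfolding tree_coverable_def
proof (intro allI impI, rule ccontr)
  fix c assume c: "edge_colouring r G c"
  assume no: "\<nexists>\<T>. finite \<T> \<and> card \<T> \<le> r ^ 2 \<and> (\<forall>T\<in>\<T>. mono_tree r G c T) \<and>
      (\<Union>T\<in>\<T>. verts T) = verts G"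
  interpret uncovered_graph r G c
  proof
    fix K assume "K \<subseteq> verts G" "card K \<le> r"
    then show "\<exists>x\<in>verts G. \<forall>v\<in>K. \<not> mono_meet r G c v x"
      using mono_cover_by_components[OF assms(1,2), of K r c] no by blast
  qed (use assms c in auto)
  \<comment> \<open>Two applications: the first with nothing to avoid, the second avoiding
    \<open>x\<close>, so that the two classes do not meet.\<close>
  obtain x where x: "x \<in> verts G" "M \<le> card (cls x)"
    using large_class[of M "{}"] many by auto
  obtain y where y: "y \<in> verts G" "M \<le> card (cls y)" "\<not> meet x y"
    using large_class[of M "{x}"] many x(1) by auto
  show False
    by (rule two_large_classes_contradiction[OF _ x y]) (rule joint)
qed

section \<open>Joint neighbours in the random graph\<close>

lemma prob_Pi_pmf_Int:
  assumes "finite I" "J \<subseteq> I"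
    and P: "\<And>f g. (\<And>e. e \<in> J \<Longrightarrow> f e = g e) \<Longrightarrow> P f = P g"
    and Q: "\<And>f g. (\<And>e. e \<in> I - J \<Longrightarrow> f e = g e) \<Longrightarrow> Q f = Q g"
  shows "measure_pmf.prob (Pi_pmf I d p) {f. P f \<and> Q f} =
    measure_pmf.prob (Pi_pmf I d p) {f. P f} * measure_pmf.prob (Pi_pmf I d p) {f. Q f}"
proof -
  define M N where "M = Pi_pmf J d p" and "N = Pi_pmf (I - J) d p"
  have I: "J \<union> (I - J) = I" using assms(2) by blast
  have U: "Pi_pmf I d p = map_pmf (\<lambda>(f, g) x. if x \<in> J then f x else g x) (pair_pmf M N)"
    using Pi_pmf_union[of J "I - J" d p] assms(1,2) finite_subset
    unfolding M_def N_def I by blast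
  have prod: "measure_pmf.prob (pair_pmf M N) (A \<times> B) = measure_pmf.prob M A * measure_pmf.prob N B" for A B
  proof -
    \<comment> \<open>Passing to the supports makes both sets countable, as the product rule below
      requires.\<close>
    have "measure_pmf.prob (pair_pmf M N) (A \<times> B) =
        measure_pmf.prob (pair_pmf M N) ((A \<inter> set_pmf M) \<times> (B \<inter> set_pmf N))"
      by (rule measure_prob_cong_0) (auto simp: pmf_pair set_pmf_iff)
    also have "\<dots> = measure_pmf.prob M (A \<inter> set_pmf M) * measure_pmf.prob N (B \<inter> set_pmf N)"
      by (rule measure_pmf_prob_product) auto
    finally show ?thesis by (simp add: measure_Int_set_pmf)
  qed
  have eq: "measure_pmf.prob (Pi_pmf I d p) {f. R f \<and> S f} =
      measure_pmf.prob M {f. R f} * measure_pmf.prob N {f. S f}"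
    if R: "\<And>f g. (\<And>e. e \<in> J \<Longrightarrow> f e = g e) \<Longrightarrow> R f = R g"
      and S: "\<And>f g. (\<And>e. e \<in> I - J \<Longrightarrow> f e = g e) \<Longrightarrow> S f = S g" for R S
  proof -
    have "R (\<lambda>x. if x \<in> J then f x else g x) = R f" "S (\<lambda>x. if x \<in> J then f x else g x) = S g" for f g
      by (rule R, simp) (rule S, simp)
    then have "(\<lambda>(f, g) x. if x \<in> J then f x else g x) -` {f. R f \<and> S f} = {f. R f} \<times> {f. S f}"
      by auto
    then show ?thesis
      unfolding U by (simp add: prod)
  qed
  \<comment> \<open>The instances with a trivial event identify the marginal probabilities under
    \<open>M\<close> and \<open>N\<close> with those under the full product.\<close>
  from eq[OF P Q] eq[where R = P and S = "\<lambda>_. True", OF P] eq[where R = "\<lambda>_. True" and S = Q, OF _ Q]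
  show ?thesis
    by simp
qed

text \<open>Induction on \<open>X\<close>: the event of the new element depends on
  \<open>J x\<close>, the others on coordinates outside \<open>J x\<close> by disjointness.\<close>

lemma prob_Pi_pmf_Ball:
  assumes "finite I" "finite X" "\<And>x. x \<in> X \<Longrightarrow> J x \<subseteq> I" "disjoint_family_on J X"
    and P: "\<And>x f g. x \<in> X \<Longrightarrow> (\<And>e. e \<in> J x \<Longrightarrow> f e = g e) \<Longrightarrow> P x f = P x g"
  shows "measure_pmf.prob (Pi_pmf I d p) {f. \<forall>x\<in>X. P x f} =
    (\<Prod>x\<in>X. measure_pmf.prob (Pi_pmf I d p) {f. P x f})"
  using assms(2-)
proof (induction X rule: finite_induct)
  case (insert x X)
  have "measure_pmf.prob (Pi_pmf I d p) {f. P x f \<and> (\<forall>y\<in>X. P y f)} =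
    measure_pmf.prob (Pi_pmf I d p) {f. P x f} * measure_pmf.prob (Pi_pmf I d p) {f. \<forall>y\<in>X. P y f}"
  proof (rule prob_Pi_pmf_Int[of I "J x"])
    show "P x f = P x g" if "\<And>e. e \<in> J x \<Longrightarrow> f e = g e" for f g
      using insert.prems(3)[of x f g] that by simp
    show "(\<forall>y\<in>X. P y f) = (\<forall>y\<in>X. P y g)" if fg: "\<And>e. e \<in> I - J x \<Longrightarrow> f e = g e" for f g
    proof (rule ball_cong[OF refl])
      fix y assume y: "y \<in> X"
      then have "J x \<inter> J y = {}" "J y \<subseteq> I"
        using insert.prems(1,2) insert.hyps(2) by (auto simp: disjoint_family_on_def)
      then show "P y f = P y g"
        using y fg by (intro insert.prems(3)) auto
    qed
  qed (use assms(1) insert.prems in auto)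
  also have "measure_pmf.prob (Pi_pmf I d p) {f. \<forall>y\<in>X. P y f} =
      (\<Prod>x\<in>X. measure_pmf.prob (Pi_pmf I d p) {f. P x f})"
  proof (rule insert.IH)
    show "disjoint_family_on J X"
      using insert.prems(2) by (auto simp: disjoint_family_on_def)
    show "P y f = P y g" if "y \<in> X" "\<And>e. e \<in> J y \<Longrightarrow> f e = g e" for y f g
      by (rule insert.prems(3)) (use that in auto)
  qed (use insert.prems(1) in auto)
  finally show ?case
    using insert.hyps by simp
qed simp

lemma prob_Pi_pmf_compl:
  "measure_pmf.prob M {f. \<not> P f} = 1 - measure_pmf.prob M {f. P f}"
  using measure_pmf.prob_compl[of "{f. P f}" M] by (simp add: Compl_eq_Diff_UNIV[symmetric] Collect_neg_eq)

section \<open>The probability that no joint neighbour exists\<close>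

abbreviation edge_pmf :: "nat \<Rightarrow> real \<Rightarrow> (nat set \<Rightarrow> bool) pmf" where
  "edge_pmf n p \<equiv> Pi_pmf ([{..<n}]\<^bsup>2\<^esup>) False (\<lambda>_. bernoulli_pmf p)"

abbreviation graph_of :: "nat \<Rightarrow> (nat set \<Rightarrow> bool) \<Rightarrow> nat ugraph" where
  "graph_of n f \<equiv> \<lparr>verts = {..<n}, edges = {e \<in> [{..<n}]\<^bsup>2\<^esup>. f e}\<rparr>"

text \<open>For \<open>z\<close> outside \<open>S\<close> and \<open>w\<close> inside, distinct
  pairs give distinct edges. Independence is therefore used three times: over the elements of one
  \<open>A\<close>, over the members of \<open>\<A>\<close>, and over the vertices
  \<open>z\<close>.\<close>

lemma prob_no_joint_neighbour:
  assumes "finite \<A>" "disjoint \<A>" "\<Union>\<A> \<subseteq> S" "S \<subseteq> {..<n}" "0 \<le> p" "p \<le> 1"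
  shows "measure_pmf.prob (edge_pmf n p) {f. \<forall>z\<in>{..<n} - S. \<not> joint_neighbour (graph_of n f) \<A> z} =
    (1 - (\<Prod>A\<in>\<A>. 1 - (1 - p) ^ card A)) ^ (n - card S)"
proof -
  let ?P = "measure_pmf.prob (edge_pmf n p)"
  have finE: "finite ([{..<n}]\<^bsup>2\<^esup>)"
    by (simp add: finite_imp_finite_nsets)
  have edge: "{z, w} \<in> [{..<n}]\<^bsup>2\<^esup>" if "z \<in> {..<n} - S" "w \<in> S" for z w
    using that assms(4) by auto
  have single: "?P {f. \<not> f e} = 1 - p" if "e \<in> [{..<n}]\<^bsup>2\<^esup>" for e
  proof -
    have "map_pmf (\<lambda>f. f e) (edge_pmf n p) = bernoulli_pmf p"
      using Pi_pmf_component[OF finE, of e False "\<lambda>_. bernoulli_pmf p"] that by simp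
    moreover have "?P {f. \<not> f e} = measure_pmf.prob (map_pmf (\<lambda>f. f e) (edge_pmf n p)) {False}"
      by (simp add: vimage_def)
    ultimately have "?P {f. \<not> f e} = measure_pmf.prob (bernoulli_pmf p) {False}"
      by simp
    then show ?thesis
      using assms(5,6) by (simp add: measure_pmf_single)
  qed
  have set: "?P {f. \<forall>w\<in>A. \<not> f {z, w}} = (1 - p) ^ card A" if z: "z \<in> {..<n} - S" and A: "A \<in> \<A>" for z A
  proof -
    have AS: "A \<subseteq> S" using A assms(3) by auto
    then have "finite A" using assms(4) by (meson finite_lessThan finite_subset)
    have "?P {f. \<forall>w\<in>A. \<not> f {z, w}} = (\<Prod>w\<in>A. ?P {f. \<not> f {z, w}})"
      by (rule prob_Pi_pmf_Ball[where J = "\<lambda>w. {{z, w}}"])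
         (use finE AS z edge \<open>finite A\<close> in \<open>auto simp: disjoint_family_on_def doubleton_eq_iff\<close>)
    also have "\<dots> = (\<Prod>w\<in>A. 1 - p)"
      using single edge z AS by (intro prod.cong) auto
    finally show ?thesis by simp
  qed
  have vert: "?P {f. \<not> (\<forall>A\<in>\<A>. \<exists>w\<in>A. f {z, w})} = 1 - (\<Prod>A\<in>\<A>. 1 - (1 - p) ^ card A)"
    if z: "z \<in> {..<n} - S" for z
  proof -
    have "?P {f. \<forall>A\<in>\<A>. \<exists>w\<in>A. f {z, w}} = (\<Prod>A\<in>\<A>. ?P {f. \<exists>w\<in>A. f {z, w}})"
    proof (rule prob_Pi_pmf_Ball[where J = "\<lambda>A. (\<lambda>w. {z, w}) ` A"])
      show "disjoint_family_on (\<lambda>A. (\<lambda>w. {z, w}) ` A) \<A>"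
        unfolding disjoint_family_on_def
      proof (intro ballI impI)
        fix A B assume "A \<in> \<A>" "B \<in> \<A>" "A \<noteq> B"
        then have "A \<inter> B = {}"
          using assms(2) by (auto simp: disjoint_def)
        then show "(\<lambda>w. {z, w}) ` A \<inter> (\<lambda>w. {z, w}) ` B = {}"
          by (auto simp: doubleton_eq_iff)
      qed
      show "(\<lambda>w. {z, w}) ` A \<subseteq> [{..<n}]\<^bsup>2\<^esup>" if "A \<in> \<A>" for A
        using edge[OF z] that assms(3) by blast
    qed (use assms(1) finE in auto)
    also have "\<dots> = (\<Prod>A\<in>\<A>. 1 - (1 - p) ^ card A)"
    proof (rule prod.cong[OF refl])
      fix A assume "A \<in> \<A>"
      then show "?P {f. \<exists>w\<in>A. f {z, w}} = 1 - (1 - p) ^ card A"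
        using prob_Pi_pmf_compl[of "edge_pmf n p" "\<lambda>f. \<forall>w\<in>A. \<not> f {z, w}"] set[OF z] by simp
    qed
    finally show ?thesis
      by (simp only: prob_Pi_pmf_compl)
  qed
  have "{f. \<forall>z\<in>{..<n} - S. \<not> joint_neighbour (graph_of n f) \<A> z} =
      {f. \<forall>z\<in>{..<n} - S. \<not> (\<forall>A\<in>\<A>. \<exists>w\<in>A. f {z, w})}"
  proof (intro Collect_cong ball_cong refl arg_cong[where f = Not])
    fix f z assume z: "z \<in> {..<n} - S"
    have "{z, w} \<in> [{..<n}]\<^bsup>2\<^esup>" if "A \<in> \<A>" "w \<in> A" for A w
      using edge[OF z] that assms(3) by blast
    then show "joint_neighbour (graph_of n f) \<A> z = (\<forall>A\<in>\<A>. \<exists>w\<in>A. f {z, w})"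
      unfolding joint_neighbour_def by (auto simp del: doubleton_in_nsets_2)
  qed
  also have "?P \<dots> = (\<Prod>z\<in>{..<n} - S. ?P {f. \<not> (\<forall>A\<in>\<A>. \<exists>w\<in>A. f {z, w})})"
  proof (rule prob_Pi_pmf_Ball[where J = "\<lambda>z. (\<lambda>w. {z, w}) ` S"])
    show "disjoint_family_on (\<lambda>z. (\<lambda>w. {z, w}) ` S) ({..<n} - S)"
      by (auto simp: disjoint_family_on_def doubleton_eq_iff)
    fix z and f g :: "nat set \<Rightarrow> bool"
    assume "\<And>e. e \<in> (\<lambda>w. {z, w}) ` S \<Longrightarrow> f e = g e"
    then show "(\<not> (\<forall>A\<in>\<A>. \<exists>w\<in>A. f {z, w})) = (\<not> (\<forall>A\<in>\<A>. \<exists>w\<in>A. g {z, w}))"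
      using assms(3) by (metis UnionI imageI subsetD)
  qed (use finE edge in auto)
  also have "\<dots> = (\<Prod>z\<in>{..<n} - S. 1 - (\<Prod>A\<in>\<A>. 1 - (1 - p) ^ card A))"
    using vert by (intro prod.cong) auto
  also have "\<dots> = (1 - (\<Prod>A\<in>\<A>. 1 - (1 - p) ^ card A)) ^ (n - card S)"
    using assms(4) finite_subset[OF assms(4)] by (simp add: card_Diff_subset)
  finally show ?thesis .
qed

text \<open>From \<open>1 - q \<le> exp (- q)\<close>, with at least \<open>n / 2\<close> vertices
  left outside \<open>S\<close>.\<close>

lemma prob_no_joint_neighbour_le:
  assumes "finite \<A>" "disjoint \<A>" "\<Union>\<A> \<subseteq> S" "S \<subseteq> {..<n}" "0 \<le> p" "p \<le> 1"
    and q: "0 \<le> q" "q \<le> (\<Prod>A\<in>\<A>. 1 - (1 - p) ^ card A)" and S: "2 * card S \<le> n"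
  shows "measure_pmf.prob (edge_pmf n p) {f. \<forall>z\<in>{..<n} - S. \<not> joint_neighbour (graph_of n f) \<A> z}
    \<le> exp (- (real n * q / 2))"
proof -
  let ?Q = "\<Prod>A\<in>\<A>. 1 - (1 - p) ^ card A"
  have "?Q \<le> 1"
    using assms(5,6) by (intro prod_le_1) (auto intro: power_le_one)
  have "(1 - ?Q) ^ (n - card S) \<le> exp (- q) ^ (n - card S)"
  proof (rule power_mono)
    show "1 - ?Q \<le> exp (- q)"
      using exp_ge_add_one_self[of "- q"] q(2) by linarith
  qed (use \<open>?Q \<le> 1\<close> in simp)
  also have "\<dots> = exp (- (real (n - card S) * q))"
    by (simp add: exp_of_nat_mult[symmetric])
  also have "\<dots> \<le> exp (- (real n * q / 2))"
    using S q(1) mult_right_mono[of "real n / 2" "real (n - card S)" q] by auto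
  finally show ?thesis
    by (simp only: prob_no_joint_neighbour[OF assms(1-6)])
qed

section \<open>Elementary estimates for the union bounds\<close>

lemma one_minus_power_ge_half:
  fixes p :: real
  assumes "0 \<le> p" "p \<le> 1"
  shows "min 1 (real m * p) / 2 \<le> 1 - (1 - p) ^ m"
proof -
  define a where "a = real m * p"
  have a: "0 \<le> a" using assms by (simp add: a_def)
  \<comment> \<open>Bernoulli's inequality is applied to \<open>1 + p\<close> rather than
    \<open>1 - p\<close>; the product then collapses to
    \<open>(1 - p\<^sup>2) ^ m \<le> 1\<close>.\<close>
  have "(1 - p) ^ m * (1 + a) \<le> (1 - p) ^ m * (1 + p) ^ m"
    using Bernoulli_inequality[of p m] assms by (intro mult_left_mono) (auto simp: a_def)
  also have "\<dots> = (1 - p\<^sup>2) ^ m"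
    by (simp add: power_mult_distrib[symmetric] algebra_simps power2_eq_square)
  also have "\<dots> \<le> 1"
    using assms by (intro power_le_one) (auto simp: power_le_one)
  finally have "(1 - p) ^ m \<le> 1 / (1 + a)"
    using a by (simp add: pos_le_divide_eq)
  moreover have "1 / (1 + a) \<le> 1 - min 1 a / 2"
  proof -
    have "1 \<le> (1 - min 1 a / 2) * (1 + a)"
    proof (cases "a \<le> 1")
      case True
      then have "a * a \<le> a * 1" using a by (intro mult_left_mono)
      with True show ?thesis by (simp add: algebra_simps)
    qed simp
    then show ?thesis
      using a by (simp add: pos_divide_le_eq)
  qed
  ultimately show ?thesis
    unfolding a_def[symmetric] by linarith
qed

lemma card_subsets_of_card_le:
  "card {S. S \<subseteq> {..<n} \<and> card S = k} \<le> n ^ k"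
proof (cases "k \<le> n")
  case True
  then show ?thesis
    using n_subsets[of "{..<n}" k] binomial_le_pow[OF True] by simp
next
  case False
  then show ?thesis
    using n_subsets[OF finite_lessThan, of n k] by (simp only: card_lessThan binomial_eq_0)
qed

lemma prob_UN_le:
  assumes "finite I" "\<And>i. i \<in> I \<Longrightarrow> measure_pmf.prob M (B i) \<le> b" "real (card I) \<le> N" "0 \<le> b"
  shows "measure_pmf.prob M (\<Union>i\<in>I. B i) \<le> N * b"
proof -
  have "measure_pmf.prob M (\<Union>i\<in>I. B i) \<le> (\<Sum>i\<in>I. measure_pmf.prob M (B i))"
    by (rule measure_pmf.finite_measure_subadditive_finite) (use assms(1) in auto)
  also have "\<dots> \<le> real (card I) * b"
    using sum_bounded_above[of I "\<lambda>i. measure_pmf.prob M (B i)" b] assms(2) by simp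
  also have "\<dots> \<le> N * b"
    using assms(3,4) by (rule mult_right_mono)
  finally show ?thesis .
qed

lemma prod_singletons_nonadjacent:
  fixes p :: real
  assumes "finite U"
  shows "(\<Prod>A\<in>(\<lambda>u. {u}) ` U. 1 - (1 - p) ^ card A) = p ^ card U"
  by (subst prod.reindex) (auto simp: inj_on_def)

section \<open>The two kinds of bad events and their probabilities\<close>

definition few_joint_neighbours :: "nat \<Rightarrow> 'a ugraph \<Rightarrow> nat \<Rightarrow> bool" where
  "few_joint_neighbours r G m \<longleftrightarrow> (\<exists>U\<subseteq>verts G. \<exists>W\<subseteq>verts G. U \<inter> W = {} \<and> card U = r - 1 \<and> card W = m \<and>
     card {z \<in> verts G - (U \<union> W). joint_neighbour G (insert W ((\<lambda>u. {u}) ` U)) z} \<le> r ^ r * m)"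

definition lacks_joint_neighbour :: "nat \<Rightarrow> 'a ugraph \<Rightarrow> nat \<Rightarrow> bool" where
  "lacks_joint_neighbour r G m \<longleftrightarrow> (\<exists>U\<subseteq>verts G. \<exists>W\<subseteq>verts G. \<exists>W'\<subseteq>verts G.
     U \<inter> W = {} \<and> U \<inter> W' = {} \<and> W \<inter> W' = {} \<and> card U = r - 1 \<and> card W = m \<and> card W' = m \<and>
     (\<nexists>z. joint_neighbour G (insert W (insert W' ((\<lambda>u. {u}) ` U))) z))"

text \<open>If there are few joint neighbours, they fit together with \<open>U\<close> and
  \<open>W\<close> into a set \<open>S\<close> of size exactly \<open>L\<close>, and no vertex
  outside \<open>S\<close> is a joint neighbour. The union bound runs over the triples
  \<open>(U, W, S)\<close>. As \<open>real m * p \<le> 1\<close>, a vertex has a neighbour in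
  \<open>W\<close> with probability at least \<open>real m * p / 2\<close>.\<close>

lemma prob_few_joint_neighbours:
  assumes p: "0 \<le> p" "p \<le> 1" and m: "0 < m" "real m * p \<le> 1"
    and L: "L = r ^ r * m + (r - 1) + m" "2 * L \<le> n"
  shows "measure_pmf.prob (edge_pmf n p) {f. few_joint_neighbours r (graph_of n f) m}
    \<le> real n ^ (r - 1 + m + L) * exp (- (real n * (real m * p / 2 * p ^ (r - 1)) / 2))"
proof -
  let ?A = "\<lambda>k. {S. S \<subseteq> {..<n} \<and> card S = k}"
  let ?\<A> = "\<lambda>U W. insert W ((\<lambda>u. {u}) ` U)"
  define I where "I = {(U, W, S) \<in> ?A (r - 1) \<times> ?A m \<times> ?A L. U \<inter> W = {} \<and> U \<union> W \<subseteq> S}"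
  define B where "B = (\<lambda>(U, W, S). {f. \<forall>z\<in>{..<n} - S. \<not> joint_neighbour (graph_of n f) (?\<A> U W) z})"
  have "{f. few_joint_neighbours r (graph_of n f) m} \<subseteq> (\<Union>i\<in>I. B i)"
  proof
    fix f assume "f \<in> {f. few_joint_neighbours r (graph_of n f) m}"
    then obtain U W where UW: "U \<subseteq> {..<n}" "W \<subseteq> {..<n}" "U \<inter> W = {}" "card U = r - 1" "card W = m"
      and Z: "card {z \<in> {..<n} - (U \<union> W). joint_neighbour (graph_of n f) (?\<A> U W) z} \<le> r ^ r * m"
      by (auto simp: few_joint_neighbours_def)
    let ?Z = "{z \<in> {..<n} - (U \<union> W). joint_neighbour (graph_of n f) (?\<A> U W) z}"
    have "card (?Z \<union> (U \<union> W)) \<le> L"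
      using card_Un_le[of ?Z "U \<union> W"] card_Un_le[of U W] UW Z L(1) by linarith
    moreover have "L \<le> card {..<n}" using L(2) by simp
    ultimately obtain S where S: "?Z \<union> (U \<union> W) \<subseteq> S" "S \<subseteq> {..<n}" "card S = L"
      using exists_subset_between[of "?Z \<union> (U \<union> W)" L "{..<n}"] UW(1,2) by auto
    then have "(U, W, S) \<in> I"
      using UW by (auto simp: I_def)
    moreover have "f \<in> B (U, W, S)"
      using S(1) by (auto simp: B_def)
    ultimately show "f \<in> (\<Union>i\<in>I. B i)" by blast
  qed
  then have "measure_pmf.prob (edge_pmf n p) {f. few_joint_neighbours r (graph_of n f) m} \<le>
      measure_pmf.prob (edge_pmf n p) (\<Union>i\<in>I. B i)"
    by (intro measure_pmf.finite_measure_mono) auto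
  also have "\<dots> \<le> real n ^ (r - 1 + m + L) * exp (- (real n * (real m * p / 2 * p ^ (r - 1)) / 2))"
  proof (rule prob_UN_le)
    have sub: "I \<subseteq> ?A (r - 1) \<times> ?A m \<times> ?A L" by (auto simp: I_def)
    have fin: "finite (?A (r - 1) \<times> ?A m \<times> ?A L)" by (intro finite_cartesian_product) auto
    show "finite I" using sub fin by (rule finite_subset)
    have "card I \<le> card (?A (r - 1)) * (card (?A m) * card (?A L))"
      using card_mono[OF fin sub] by (simp only: card_cartesian_product)
    also have "\<dots> \<le> n ^ (r - 1) * (n ^ m * n ^ L)"
      by (intro mult_mono card_subsets_of_card_le) auto
    finally have "card I \<le> n ^ (r - 1 + m + L)"
      by (simp add: power_add mult.assoc)
    then show "real (card I) \<le> real n ^ (r - 1 + m + L)"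
      by (metis of_nat_le_iff of_nat_power)
  next
    fix i assume "i \<in> I"
    then obtain U W S where i: "i = (U, W, S)" and UW: "U \<subseteq> {..<n}" "W \<subseteq> {..<n}" "S \<subseteq> {..<n}"
      "card U = r - 1" "card W = m" "card S = L" "U \<inter> W = {}" "U \<union> W \<subseteq> S"
      by (auto simp: I_def)
    have finU: "finite U" using UW(1) finite_subset by blast
    \<comment> \<open>The family is a set, so \<open>W\<close> has to differ from the singletons to
      contribute its own factor.\<close>
    have "W \<notin> (\<lambda>u. {u}) ` U"
      using UW(7) by auto
    then have "(\<Prod>A\<in>?\<A> U W. 1 - (1 - p) ^ card A) = (1 - (1 - p) ^ m) * p ^ (r - 1)"
      using finU UW by (simp add: prod_singletons_nonadjacent)
    moreover have "real m * p / 2 * p ^ (r - 1) \<le> (1 - (1 - p) ^ m) * p ^ (r - 1)"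
      using one_minus_power_ge_half[OF p, of m] m(2) p(1) by (intro mult_right_mono) auto
    moreover have "disjoint (?\<A> U W)"
      using UW(7) by (auto simp: disjoint_def)
    ultimately show "measure_pmf.prob (edge_pmf n p) (B i) \<le>
        exp (- (real n * (real m * p / 2 * p ^ (r - 1)) / 2))"
      unfolding B_def i prod.case
      by (intro prob_no_joint_neighbour_le) (use UW finU p L(2) in auto)
  qed auto
  finally show ?thesis .
qed

text \<open>As \<open>1 \<le> real m * p\<close>, a vertex has a neighbour in \<open>W\<close> with
  probability at least \<open>1 / 2\<close>, and likewise for \<open>W'\<close>; this gives the
  factor \<open>1 / 4\<close>.\<close>

lemma prob_lacks_joint_neighbour:
  assumes p: "0 \<le> p" "p \<le> 1" and m: "1 \<le> real m * p"
    and n: "2 * (r - 1 + 2 * m) \<le> n"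
  shows "measure_pmf.prob (edge_pmf n p) {f. lacks_joint_neighbour r (graph_of n f) m}
    \<le> real n ^ (r - 1 + 2 * m) * exp (- (real n * (p ^ (r - 1) / 4) / 2))"
proof -
  let ?A = "\<lambda>k. {S. S \<subseteq> {..<n} \<and> card S = k}"
  let ?\<A> = "\<lambda>U W W'. insert W (insert W' ((\<lambda>u. {u}) ` U))"
  define I where "I = {(U, W, W') \<in> ?A (r - 1) \<times> ?A m \<times> ?A m. U \<inter> W = {} \<and> U \<inter> W' = {} \<and> W \<inter> W' = {}}"
  define B where "B = (\<lambda>(U, W, W'). {f. \<forall>z\<in>{..<n} - (U \<union> W \<union> W').
    \<not> joint_neighbour (graph_of n f) (?\<A> U W W') z})"
  have "{f. lacks_joint_neighbour r (graph_of n f) m} \<subseteq> (\<Union>i\<in>I. B i)"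
  proof
    fix f assume "f \<in> {f. lacks_joint_neighbour r (graph_of n f) m}"
    then obtain U W W' where "U \<subseteq> {..<n}" "W \<subseteq> {..<n}" "W' \<subseteq> {..<n}"
      "U \<inter> W = {}" "U \<inter> W' = {}" "W \<inter> W' = {}" "card U = r - 1" "card W = m" "card W' = m"
      "\<nexists>z. joint_neighbour (graph_of n f) (?\<A> U W W') z"
      by (auto simp: lacks_joint_neighbour_def)
    then have "(U, W, W') \<in> I" "f \<in> B (U, W, W')"
      by (auto simp: I_def B_def)
    then show "f \<in> (\<Union>i\<in>I. B i)" by blast
  qed
  then have "measure_pmf.prob (edge_pmf n p) {f. lacks_joint_neighbour r (graph_of n f) m} \<le>
      measure_pmf.prob (edge_pmf n p) (\<Union>i\<in>I. B i)"
    by (intro measure_pmf.finite_measure_mono) auto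
  also have "\<dots> \<le> real n ^ (r - 1 + 2 * m) * exp (- (real n * (p ^ (r - 1) / 4) / 2))"
  proof (rule prob_UN_le)
    have sub: "I \<subseteq> ?A (r - 1) \<times> ?A m \<times> ?A m" by (auto simp: I_def)
    have fin: "finite (?A (r - 1) \<times> ?A m \<times> ?A m)" by (intro finite_cartesian_product) auto
    show "finite I" using sub fin by (rule finite_subset)
    have "card I \<le> card (?A (r - 1)) * (card (?A m) * card (?A m))"
      using card_mono[OF fin sub] by (simp only: card_cartesian_product)
    also have "\<dots> \<le> n ^ (r - 1) * (n ^ m * n ^ m)"
      by (intro mult_mono card_subsets_of_card_le) auto
    finally have "card I \<le> n ^ (r - 1 + 2 * m)"
      by (simp add: power_add mult_2)
    then show "real (card I) \<le> real n ^ (r - 1 + 2 * m)"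
      by (metis of_nat_le_iff of_nat_power)
  next
    fix i assume "i \<in> I"
    then obtain U W W' where i: "i = (U, W, W')" and UW: "U \<subseteq> {..<n}" "W \<subseteq> {..<n}" "W' \<subseteq> {..<n}"
      "card U = r - 1" "card W = m" "card W' = m" "U \<inter> W = {}" "U \<inter> W' = {}" "W \<inter> W' = {}"
      by (auto simp: I_def)
    have finU: "finite U" using UW(1) finite_subset by blast
    have "W \<notin> (\<lambda>u. {u}) ` U" "W' \<notin> (\<lambda>u. {u}) ` U"
      using UW(7,8) by auto
    \<comment> \<open>Disjoint sets differ only if they are not both empty.\<close>
    moreover have "0 < m"
      using m by (cases m) auto
    then have "W \<noteq> W'"
      using UW(5,9) by auto
    ultimately have prod: "(\<Prod>A\<in>?\<A> U W W'. 1 - (1 - p) ^ card A) =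
        (1 - (1 - p) ^ m) * ((1 - (1 - p) ^ m) * p ^ (r - 1))"
      using finU UW by (simp add: prod_singletons_nonadjacent)
    have half: "1 / 2 \<le> 1 - (1 - p) ^ m"
      using one_minus_power_ge_half[OF p, of m] m by simp
    have "1 / 2 * (1 / 2 * p ^ (r - 1)) \<le> (1 - (1 - p) ^ m) * ((1 - (1 - p) ^ m) * p ^ (r - 1))"
      using half p(1) by (intro mult_mono) auto
    then have q: "p ^ (r - 1) / 4 \<le> (\<Prod>A\<in>?\<A> U W W'. 1 - (1 - p) ^ card A)"
      unfolding prod by simp
    have "disjoint (?\<A> U W W')"
      using UW(7-9) by (auto simp: disjoint_def)
    moreover have "card (U \<union> W \<union> W') \<le> r - 1 + 2 * m"
      using card_Un_le[of "U \<union> W" W'] card_Un_le[of U W] UW(4-6) by linarith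
    ultimately show "measure_pmf.prob (edge_pmf n p) (B i) \<le> exp (- (real n * (p ^ (r - 1) / 4) / 2))"
      unfolding B_def i prod.case
      by (intro prob_no_joint_neighbour_le q) (use UW finU p n in auto)
  qed auto
  finally show ?thesis .
qed

text \<open>The surplus 2 over the exponent \<open>k\<close> leaves \<open>1 / real n ^ 2\<close>,
  small enough for a union bound over \<open>n\<close> events.\<close>

lemma power_times_exp_le:
  assumes "0 < n" "(real k + 2) * ln (real n) \<le> x"
  shows "real n ^ k * exp (- x) \<le> 1 / real n ^ 2"
proof -
  have "exp (- x) \<le> exp (- (real (k + 2) * ln (real n)))"
    using assms(2) by (simp add: add.commute)
  also have "\<dots> = 1 / real n ^ (k + 2)"
    using assms(1) by (simp only: exp_minus exp_of_nat_mult exp_ln of_nat_0_less_iff inverse_eq_divide)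
  finally have "real n ^ k * exp (- x) \<le> real n ^ k * (1 / real n ^ (k + 2))"
    by (intro mult_left_mono) auto
  also have "\<dots> = 1 / real n ^ 2"
    using assms(1) by (simp add: power_add power2_eq_square)
  finally show ?thesis .
qed

section \<open>From the bad events to the tree cover number\<close>

lemma tree_coverable_if_enough_joint_neighbours:
  assumes "finite (verts G)" "simple_graph G" "0 < r"
    and "\<And>m. 0 < m \<Longrightarrow> m < M \<Longrightarrow> \<not> few_joint_neighbours r G m" "\<not> lacks_joint_neighbour r G M"
  shows "tree_coverable r G (r ^ 2)"
proof (rule tree_coverable_if_joint_neighbours[OF assms(1-3)])
  fix U W assume "U \<subseteq> verts G" "W \<subseteq> verts G" "U \<inter> W = {}" "card U = r - 1" "0 < card W" "card W < M"
  then show "r ^ r * card W < card {z \<in> verts G - (U \<union> W). joint_neighbour G (insert W ((\<lambda>u. {u}) ` U)) z}"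
    using assms(4)[of "card W"] unfolding few_joint_neighbours_def not_le[symmetric] by blast
next
  fix U W W'
  assume "U \<subseteq> verts G" "W \<subseteq> verts G" "W' \<subseteq> verts G" "U \<inter> W = {}" "U \<inter> W' = {}" "W \<inter> W' = {}"
    "card U = r - 1" "card W = M" "card W' = M"
  then show "\<exists>z. joint_neighbour G (insert W (insert W' ((\<lambda>u. {u}) ` U))) z"
    using assms(5) unfolding lacks_joint_neighbour_def by blast
qed

text \<open>The threshold size is \<open>1 / p\<close>, rounded up to \<open>M\<close>: below it the
  bound for few joint neighbours applies, at \<open>M\<close> the bound for two large sets.
  \<open>K\<close> is large enough to dominate the exponents of \<open>n\<close> in both union
  bounds.\<close>

lemma prob_tc_gnp:
  fixes r n :: nat and p K :: real
  assumes r: "0 < r" and n: "3 \<le> n" and p: "0 \<le> p" "p \<le> 1"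
    and K: "K = real (r ^ r + 2 * r + 5)" and big: "8 * K * ln (real n) \<le> real n * p ^ r"
  shows "1 - 2 / real n \<le> measure_pmf.prob (gnp n p) {G. tc r G \<le> r ^ 2}"
proof -
  let ?P = "measure_pmf.prob (edge_pmf n p)"
  have ln: "1 \<le> ln (real n)"
    using n exp_le ln_ge_iff[of "real n" 1] by linarith
  have K1: "1 \<le> K" by (simp add: K)
  have p0: "0 < p"
  proof (rule ccontr)
    assume "\<not> 0 < p"
    then have "p ^ r = 0" using p(1) r by simp
    then have "8 * K * ln (real n) \<le> 0" using big by (simp only: mult_zero_right)
    then show False using ln K1 by (auto simp: mult_le_0_iff)
  qed
  \<comment> \<open>With \<open>p ^ r \<le> p\<close> this yields
    \<open>8 * K / p \<le> real n\<close>, so all sets of size of order \<open>1 / p\<close> below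
    occupy at most half of the vertices.\<close>
  have "8 * K \<le> 8 * K * ln (real n)"
    using ln K1 mult_left_mono[of 1 "ln (real n)" "8 * K"] by simp
  also have "\<dots> \<le> real n * p"
    using big power_decreasing[of 1 r p] p r mult_left_mono[of "p ^ r" p "real n"] by simp
  finally have np: "8 * K / p \<le> real n"
    using p0 by (simp add: pos_divide_le_eq)
  have pinv: "1 \<le> 1 / p" using p0 p(2) by simp
  define M where "M = nat \<lceil>1 / p\<rceil>"
  have M1: "1 \<le> real M * p" and M2: "real M \<le> 2 / p" and M3: "\<And>m. m < M \<Longrightarrow> real m \<le> 1 / p"
  proof -
    have "1 / p \<le> real M" unfolding M_def by (rule real_nat_ceiling_ge)
    then show "1 \<le> real M * p" using p0 by (simp add: pos_divide_le_eq)
    have "real M \<le> 1 / p + 1" unfolding M_def using p0 by (simp add: of_nat_ceiling)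
    also have "\<dots> \<le> 2 / p" using pinv by (simp add: add_divide_distrib[symmetric] field_simps)
    finally show "real M \<le> 2 / p" .
    show "real m \<le> 1 / p" if "m < M" for m
      using that unfolding M_def by linarith
  qed
  have few: "?P {f. few_joint_neighbours r (graph_of n f) m} \<le> 1 / real n ^ 2" if m: "0 < m" "m < M" for m
  proof -
    define L where "L = r ^ r * m + (r - 1) + m"
    have mp: "real m * p \<le> 1"
      using M3[OF m(2)] p0 by (simp add: pos_le_divide_eq)
    have "2 * L \<le> n"
    proof -
      have "2 * L \<le> 2 * (r ^ r + r + 1) * m"
        using m(1) r unfolding L_def by (cases r; cases m) (auto simp: algebra_simps)
      then have "real (2 * L) \<le> real (2 * (r ^ r + r + 1) * m)"
        by (rule of_nat_mono)
      also have "\<dots> = real (2 * (r ^ r + r + 1)) * real m"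
        by (rule of_nat_mult)
      also have "\<dots> \<le> 8 * K * (1 / p)"
        using M3[OF m(2)] by (intro mult_mono) (auto simp: K)
      also have "\<dots> \<le> real n" using np by simp
      finally show ?thesis by simp
    qed
    from prob_few_joint_neighbours[OF p m(1) mp L_def this]
    have "?P {f. few_joint_neighbours r (graph_of n f) m} \<le>
      real n ^ (r - 1 + m + L) * exp (- (real n * (real m * p / 2 * p ^ (r - 1)) / 2))" .
    also have "\<dots> \<le> 1 / real n ^ 2"
    proof (rule power_times_exp_le)
      have pr: "p * p ^ (r - 1) = p ^ r"
        using r by (metis Suc_diff_1 power_Suc)
      \<comment> \<open>The left side equals \<open>r ^ r * m + 2 * m + 2 * r\<close>. Since
        \<open>m\<close> is positive, this is bounded by a multiple of \<open>m\<close>, as is the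
        exponent in \<open>exp\<close>, so one \<open>K\<close> serves for all
        \<open>m\<close>.\<close>
      have "r - 1 + m + L + 2 \<le> 2 * (r ^ r + 2 * r + 5) * m"
        using m(1) r unfolding L_def by (cases r; cases m) (auto simp: algebra_simps)
      then have "real (r - 1 + m + L + 2) \<le> real (2 * (r ^ r + 2 * r + 5) * m)"
        by (rule of_nat_mono)
      also have "\<dots> = 2 * K * real m"
        by (simp add: K)
      finally have "(real (r - 1 + m + L) + 2) * ln (real n) \<le> 2 * K * real m * ln (real n)"
        using ln by (intro mult_right_mono) auto
      also have "\<dots> = (8 * K * ln (real n)) * (real m / 4)"
        by simp
      also have "\<dots> \<le> (real n * p ^ r) * (real m / 4)"
        using big by (rule mult_right_mono) simp
      also have "\<dots> = real n * (real m * p / 2 * p ^ (r - 1)) / 2"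
        by (simp add: pr[symmetric])
      finally show "(real (r - 1 + m + L) + 2) * ln (real n) \<le> \<dots>" .
    qed (use n in simp)
    finally show ?thesis .
  qed
  have lacks: "?P {f. lacks_joint_neighbour r (graph_of n f) M} \<le> 1 / real n ^ 2"
  proof -
    have r1: "real (r - 1) \<le> real r * (1 / p)"
      using mult_mono[OF order_refl pinv, of "real r"] r by (simp add: of_nat_diff)
    have "real (2 * (r - 1 + 2 * M)) \<le> 2 * (real r * (1 / p)) + 8 * (1 / p)"
      using M2 r1 by simp
    also have "\<dots> = (2 * real r + 8) * (1 / p)"
      by (simp only: distrib_right mult.assoc)
    also have "\<dots> \<le> 8 * K * (1 / p)"
      using p0 by (intro mult_right_mono) (auto simp: K)
    also have "\<dots> \<le> real n" using np by simp
    finally have "2 * (r - 1 + 2 * M) \<le> n"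
      by (simp only: of_nat_le_iff)
    from prob_lacks_joint_neighbour[OF p M1 this]
    have "?P {f. lacks_joint_neighbour r (graph_of n f) M} \<le>
      real n ^ (r - 1 + 2 * M) * exp (- (real n * (p ^ (r - 1) / 4) / 2))" .
    also have "\<dots> \<le> 1 / real n ^ 2"
    proof (rule power_times_exp_le)
      have "real (r - 1 + 2 * M) + 2 \<le> real r * (1 / p) + 4 * (1 / p) + 2 * (1 / p)"
        using M2 r1 pinv by simp
      also have "\<dots> = (real r + 6) * (1 / p)"
        by (simp add: add_divide_distrib)
      also have "\<dots> \<le> K * (1 / p)"
      proof (rule mult_right_mono)
        have "r + 6 \<le> r ^ r + 2 * r + 5" using r by simp
        then have "real (r + 6) \<le> real (r ^ r + 2 * r + 5)" by (rule of_nat_mono)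
        then show "real r + 6 \<le> K" by (simp add: K)
      qed (use p0 in simp)
      finally have "(real (r - 1 + 2 * M) + 2) * ln (real n) \<le> K * (1 / p) * ln (real n)"
        using ln by (intro mult_right_mono) auto
      \<comment> \<open>The 8 in \<open>big\<close> comes from here: the exponent
        \<open>real n * p ^ (r - 1) / 8\<close> is \<open>real n * p ^ r\<close> divided by
        \<open>8 * p\<close>.\<close>
      also have "\<dots> = (8 * K * ln (real n)) * (1 / (8 * p))"
        by simp
      also have "\<dots> \<le> (real n * p ^ r) * (1 / (8 * p))"
        using big p0 by (intro mult_right_mono) auto
      also have "p ^ r = p * p ^ (r - 1)"
        using r by (metis Suc_diff_1 power_Suc)
      also have "(real n * (p * p ^ (r - 1))) * (1 / (8 * p)) = real n * (p ^ (r - 1) / 4) / 2"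
        using p0 by simp
      finally show "(real (r - 1 + 2 * M) + 2) * ln (real n) \<le> \<dots>" .
    qed (use n in simp)
    finally show ?thesis .
  qed
  let ?A = "\<Union>m\<in>{1..<M}. {f. few_joint_neighbours r (graph_of n f) m}"
  let ?B = "{f. lacks_joint_neighbour r (graph_of n f) M}"
  \<comment> \<open>Since \<open>M \<le> n\<close>, there are at most \<open>n - 1\<close> sizes
    below \<open>M\<close>; with the event at \<open>M\<close> this makes at most \<open>n\<close>
    bad events.\<close>
  have "?P ?A \<le> (real n - 1) * (1 / real n ^ 2)"
  proof (rule prob_UN_le)
    show "real (card {1..<M}) \<le> real n - 1"
    proof -
      have "real M \<le> 2 * (1 / p)" using M2 by simp
      also have "\<dots> \<le> 8 * K * (1 / p)"
        using K1 p0 by (intro mult_right_mono) auto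
      also have "\<dots> \<le> real n" using np by simp
      finally have "M \<le> n" by simp
      then show ?thesis using n by (simp add: of_nat_diff)
    qed
  qed (use few in auto)
  then have "?P (?A \<union> ?B) \<le> (real n - 1) * (1 / real n ^ 2) + 1 / real n ^ 2"
    using measure_Un_le[of ?A "edge_pmf n p" ?B] lacks by simp
  also have "\<dots> = 1 / real n"
    using n by (simp add: field_simps power2_eq_square)
  also have "\<dots> \<le> 2 / real n"
    by (simp add: divide_right_mono)
  finally have bad: "?P (?A \<union> ?B) \<le> 2 / real n" .
  have fin: "finite ([{..<n}]\<^bsup>2\<^esup>)" by (simp add: finite_imp_finite_nsets)
  have "- (?A \<union> ?B) \<subseteq> {f. tc r (graph_of n f) \<le> r ^ 2}"
  proof
    fix f assume f: "f \<in> - (?A \<union> ?B)"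
    have "tree_coverable r (graph_of n f) (r ^ 2)"
      by (rule tree_coverable_if_enough_joint_neighbours[of _ _ M]) (use f r in \<open>auto simp: simple_graph_def\<close>)
    then show "f \<in> {f. tc r (graph_of n f) \<le> r ^ 2}"
      using tc_le_iff[of "graph_of n f" r] r by simp
  qed
  then have "?P (- (?A \<union> ?B)) \<le> ?P {f. tc r (graph_of n f) \<le> r ^ 2}"
    by (intro measure_pmf.finite_measure_mono) auto
  moreover have "?P (- (?A \<union> ?B)) = 1 - ?P (?A \<union> ?B)"
    using measure_pmf.prob_compl[of "?A \<union> ?B" "edge_pmf n p"] by (simp add: Compl_eq_Diff_UNIV)
  moreover have "measure_pmf.prob (gnp n p) {G. tc r G \<le> r ^ 2} = ?P {f. tc r (graph_of n f) \<le> r ^ 2}"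
    by (simp add: gnp_def vimage_def)
  ultimately show ?thesis
    using bad by linarith
qed

theorem theorem1p2:
  fixes r :: nat
  assumes "r \<ge> 2"
  shows "\<exists>C::real. C > 0 \<and>
    (\<forall>p :: nat \<Rightarrow> real.
       (\<forall>n. 0 \<le> p n \<and> p n \<le> 1) \<longrightarrow>
       (\<forall>\<^sub>F n in sequentially. p n > C * (ln (real n) / real n) powr (1 / real r)) \<longrightarrow>
       (\<lambda>n. measure_pmf.prob (gnp n (p n)) {G. tc r G \<le> r ^ 2}) \<longlonglongrightarrow> 1)"
proof -
  \<comment> \<open>The constant \<open>C\<close> will be \<open>8 * K\<close>.\<close>
  define K :: real where "K = real (r ^ r + 2 * r + 5)"
  have K: "1 \<le> 8 * K" by (simp add: K_def)
  have "(\<lambda>n. measure_pmf.prob (gnp n (p n)) {G. tc r G \<le> r ^ 2}) \<longlonglongrightarrow> 1"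
    if p: "\<forall>n. 0 \<le> p n \<and> p n \<le> 1"
      and ev: "\<forall>\<^sub>F n in sequentially. p n > 8 * K * (ln (real n) / real n) powr (1 / real r)" for p
  proof (rule tendsto_sandwich)
    show "\<forall>\<^sub>F n in sequentially. 1 - 2 / real n \<le> measure_pmf.prob (gnp n (p n)) {G. tc r G \<le> r ^ 2}"
      using ev eventually_ge_at_top[of 3]
    proof eventually_elim
      case (elim n)
      define x where "x = ln (real n) / real n"
      have x: "0 < x" using elim(2) by (simp add: x_def)
      \<comment> \<open>As \<open>8 * K\<close> is at least 1, its \<open>r\<close>-th power is no
        smaller, so raising the assumption on \<open>p n\<close> to the power \<open>r\<close> gives
        the bound required by \<open>prob_tc_gnp\<close>.\<close>
      have "8 * K * x \<le> (8 * K) ^ r * x"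
        using K x assms self_le_power[of "8 * K" r] by (intro mult_right_mono) auto
      also have "\<dots> = (8 * K * x powr (1 / real r)) ^ r"
        using x assms by (simp add: power_mult_distrib powr_power)
      also have "\<dots> \<le> p n ^ r"
        using elim(1) K by (intro power_mono) (auto simp: x_def)
      finally have "8 * K * x * real n \<le> p n ^ r * real n"
        by (rule mult_right_mono) simp
      then have "8 * K * ln (real n) \<le> real n * p n ^ r"
        using elim(2) by (simp add: x_def mult.commute)
      then show ?case
        using prob_tc_gnp[of r n "p n" K] p assms elim(2) K_def by auto
    qed
    show "(\<lambda>n. 1 - 2 / real n) \<longlonglongrightarrow> 1"
      using tendsto_diff[OF tendsto_const lim_const_over_n[of "2 :: real"], of "1 :: real"] by simp
  qed auto
  then show ?thesis
    using K by (intro exI[of _ "8 * K"]) auto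
qed

end
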